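(* The following data define a 2-category: 0-cells are graphs; 1-cells $G\to H$ are graph morphisms, composed as functions; for graph morphisms $f,f':G\to H$, the 2-cells $f\Rightarrow f'$ are the homotopy classes $[\alpha]$ of homotopies $\alpha$ from $f$ to $f'$; vertical composition is $[\alpha]*[\alpha']=[\alpha*\alpha']$ (concatenation); and horizontal composition of $[\alpha]:f\Rightarrow f'$ (with $f,f':G\to H$) and $[\beta]:g\Rightarrow g'$ (with $g,g':H\to K$) is $[\alpha\circ\beta]$ where $\alpha\circ\beta=g\alpha*\beta f'$. (In particular both compositions are well defined on homotopy classes, associative, unital, and satisfy the interchange law.)
   Context: A graph is a finite undirected graph $G$ with vertex set $V(G)$ and edge set $E(G)$, where loops $v\text{---}v$ are allowed and two vertices are joined by at most one edge. A graph morphism $f:G\to H$ is a map $V(G)\to V(H)$ with $v\text{---}w\Rightarrow f(v)\text{---}f(w)$. The exponential graph $H^G$ has as vertices all set maps $V(G)\to V(H)$, with $f\text{---}g$ iff for every edge $v_1\text{---}v_2$ of $G$ (loops included) $f(v_1)\text{---}g(v_2)$ in $H$. $I_n^{\ell}$ is the looped path graph with vertices $0,\dots,n$ and edges $i\text{---}i$ and $i\text{---}i+1$. A homotopy of length $n$ from a morphism $f$ to a morphism $g$ ($G\to H$) is a graph morphism $I_n^{\ell}\to H^G$ with $0\mapsto f$, $n\mapsto g$; equivalently a sequence $(f_0,\dots,f_n)$ of graph morphisms $G\to H$ with $f_0=f$, $f_n=g$, $f_i\text{---}f_{i+1}$ in $H^G$. Concatenation: $(f_0,\dots,f_n)*(h_0,\dots,h_m)=(f_0,\dots,f_n,h_1,\dots,h_m)$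 when $f_n=h_0$. Whiskering: $g\alpha=(gf_0,\dots,gf_n)$ and $\alpha e=(f_0e,\dots,f_ne)$ for morphisms $g$ out of $H$ and $e$ into $G$. Two homotopies $\lambda,\lambda'$ of the same length $n$ from $f$ to $f'$ are homotopic (and then lie in the same homotopy class) if there is a sequence $\lambda=\lambda_0,\dots,\lambda_k=\lambda'$ of homotopies of length $n$ from $f$ to $f'$ with $\lambda_j(i)\text{---}\lambda_{j+1}(i')$ in $H^G$ whenever $i\text{---}i'$ in $I_n^{\ell}$; homotopy classes are the equivalence classes of this relation. *)

theory Defs
  imports "HOL-Library.FuncSet" "HOL-Library.Uprod"
begin

section \<open>Graphs and exponential graphs\<close>

text \<open>An edge is an unordered pair of possibly equal vertices.  So loops are allowed, and
  two vertices are joined by at most one edge.\<close>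

record 'a ugraph =
  verts :: "'a set"
  edges :: "'a uprod set"

definition is_graph :: "'a ugraph \<Rightarrow> bool" where
  "is_graph G \<longleftrightarrow> finite (verts G) \<and> (\<forall>e\<in>edges G. set_uprod e \<subseteq> verts G)"

definition adj :: "'a ugraph \<Rightarrow> 'a \<Rightarrow> 'a \<Rightarrow> bool" where
  "adj G v w \<longleftrightarrow> Upair v w \<in> edges G"

text \<open>Maps \<open>V(G) \<rightarrow> V(H)\<close> are represented by functions that are \<^const>\<open>undefined\<close> outside
  \<open>V(G)\<close>, so that equality of maps is equality in HOL.\<close>

definition hom :: "'a ugraph \<Rightarrow> 'b ugraph \<Rightarrow> ('a \<Rightarrow> 'b) set" where
  "hom G H = {f \<in> verts G \<rightarrow>\<^sub>E verts H. \<forall>v w. adj G v w \<longrightarrow> adj H (f v) (f w)}"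

definition id_hom :: "'a ugraph \<Rightarrow> 'a \<Rightarrow> 'a" where
  "id_hom G = (\<lambda>v\<in>verts G. v)"

text \<open>\<open>exp_graph H G\<close> is the exponential graph \<open>H\<^sup>G\<close>.  The condition below is symmetric in
  \<open>f\<close> and \<open>g\<close>; see \<open>adj_exp_graph\<close>.\<close>

definition exp_graph :: "'b ugraph \<Rightarrow> 'a ugraph \<Rightarrow> ('a \<Rightarrow> 'b) ugraph" where
  "exp_graph H G =
    \<lparr>verts = verts G \<rightarrow>\<^sub>E verts H,
     edges = {Upair f g | f g. f \<in> verts G \<rightarrow>\<^sub>E verts H \<and> g \<in> verts G \<rightarrow>\<^sub>E verts H \<and>
                (\<forall>v w. adj G v w \<longrightarrow> adj H (f v) (g w))}\<rparr>"

definition looped_path :: "nat \<Rightarrow> nat ugraph" where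
  "looped_path n =
    \<lparr>verts = {0..n}, edges = {Upair i i | i. i \<le> n} \<union> {Upair i (Suc i) | i. i < n}\<rparr>"

lemma adj_sym: "adj G v w \<longleftrightarrow> adj G w v"
  unfolding adj_def by (metis Upair_inject)

lemma adj_exp_graph:
  "adj (exp_graph H G) f g \<longleftrightarrow>
     f \<in> verts G \<rightarrow>\<^sub>E verts H \<and> g \<in> verts G \<rightarrow>\<^sub>E verts H \<and>
     (\<forall>v w. adj G v w \<longrightarrow> adj H (f v) (g w))"
proof -
  have "adj (exp_graph H G) f g \<longleftrightarrow>
     f \<in> verts G \<rightarrow>\<^sub>E verts H \<and> g \<in> verts G \<rightarrow>\<^sub>E verts H \<and>
     ((\<forall>v w. adj G v w \<longrightarrow> adj H (f v) (g w)) \<or> (\<forall>v w. adj G v w \<longrightarrow> adj H (g v) (f w)))"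
    unfolding adj_def[of "exp_graph H G"] by (simp add: exp_graph_def) blast
  moreover have "(\<forall>v w. adj G v w \<longrightarrow> adj H (g v) (f w)) \<longleftrightarrow>
      (\<forall>v w. adj G v w \<longrightarrow> adj H (f v) (g w))"
    by (metis adj_sym)
  ultimately show ?thesis by blast
qed

lemma adj_looped_path:
  "adj (looped_path n) i j \<longleftrightarrow> i \<le> n \<and> j \<le> n \<and> (i = j \<or> j = Suc i \<or> i = Suc j)"
  unfolding adj_def looped_path_def by auto

lemma is_graph_exp_graph: "is_graph G \<Longrightarrow> is_graph H \<Longrightarrow> is_graph (exp_graph H G)"
  unfolding is_graph_def exp_graph_def by (auto intro!: finite_PiE)

lemma is_graph_looped_path: "is_graph (looped_path n)"
  unfolding is_graph_def looped_path_def by auto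


section \<open>Homotopies and homotopy classes\<close>

text \<open>A homotopy of length \<open>n\<close> is a morphism from the looped path on \<open>0, \<dots>, n\<close> to \<open>H\<^sup>G\<close>.  We
  store it as the list of its \<open>n + 1\<close> values, which makes its length part of the data.\<close>

definition homotopies_len ::
    "'a ugraph \<Rightarrow> 'b ugraph \<Rightarrow> ('a \<Rightarrow> 'b) \<Rightarrow> ('a \<Rightarrow> 'b) \<Rightarrow> nat \<Rightarrow> ('a \<Rightarrow> 'b) list set" where
  "homotopies_len G H f g n =
    {\<alpha>. length \<alpha> = Suc n \<and> (\<lambda>i\<in>{0..n}. \<alpha> ! i) \<in> hom (looped_path n) (exp_graph H G) \<and>
        \<alpha> ! 0 = f \<and> \<alpha> ! n = g}"

definition homotopies ::
    "'a ugraph \<Rightarrow> 'b ugraph \<Rightarrow> ('a \<Rightarrow> 'b) \<Rightarrow> ('a \<Rightarrow> 'b) \<Rightarrow> ('a \<Rightarrow> 'b) list set" where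
  "homotopies G H f g = (\<Union>n. homotopies_len G H f g n)"

lemma homotopies_len_iff:
  "\<alpha> \<in> homotopies_len G H f g n \<longleftrightarrow>
     length \<alpha> = Suc n \<and> \<alpha> ! 0 = f \<and> \<alpha> ! n = g \<and> (\<forall>i\<le>n. \<alpha> ! i \<in> hom G H) \<and>
     (\<forall>i<n. adj (exp_graph H G) (\<alpha> ! i) (\<alpha> ! Suc i))"
proof -
  have loop: "adj (exp_graph H G) h h \<longleftrightarrow> h \<in> hom G H" for h
    by (auto simp: adj_exp_graph hom_def)
  have "(\<lambda>i\<in>{0..n}. \<alpha> ! i) \<in> hom (looped_path n) (exp_graph H G) \<longleftrightarrow>
      (\<forall>i\<le>n. \<alpha> ! i \<in> verts (exp_graph H G)) \<and>
      (\<forall>i j. adj (looped_path n) i j \<longrightarrow> adj (exp_graph H G) (\<alpha> ! i) (\<alpha> ! j))"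
    unfolding hom_def by (auto simp: adj_looped_path) (auto simp: looped_path_def)
  also have "\<dots> \<longleftrightarrow> (\<forall>i\<le>n. \<alpha> ! i \<in> hom G H) \<and>
      (\<forall>i<n. adj (exp_graph H G) (\<alpha> ! i) (\<alpha> ! Suc i))" (is "?L \<longleftrightarrow> ?R")
  proof
    assume ?L
    then show ?R
      by (simp add: adj_looped_path loop[symmetric])
  next
    assume R: ?R
    have "\<alpha> ! i \<in> verts (exp_graph H G)" if "i \<le> n" for i
      using R that by (auto simp: hom_def exp_graph_def)
    moreover have "adj (exp_graph H G) (\<alpha> ! i) (\<alpha> ! j)" if "adj (looped_path n) i j" for i j
      using that R loop adj_sym[of "exp_graph H G"]
      by (auto simp: adj_looped_path Suc_le_eq)
    ultimately show ?L by blast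
  qed
  finally show ?thesis
    unfolding homotopies_len_def by blast
qed

definition htpy_step ::
    "'a ugraph \<Rightarrow> 'b ugraph \<Rightarrow> ('a \<Rightarrow> 'b) \<Rightarrow> ('a \<Rightarrow> 'b) \<Rightarrow> nat \<Rightarrow> ('a \<Rightarrow> 'b) list rel" where
  "htpy_step G H f g n =
    {(\<alpha>, \<beta>). \<alpha> \<in> homotopies_len G H f g n \<and> \<beta> \<in> homotopies_len G H f g n \<and>
       (\<forall>i i'. adj (looped_path n) i i' \<longrightarrow> adj (exp_graph H G) (\<alpha> ! i) (\<beta> ! i'))}"

definition homotopic ::
    "'a ugraph \<Rightarrow> 'b ugraph \<Rightarrow> ('a \<Rightarrow> 'b) \<Rightarrow> ('a \<Rightarrow> 'b) \<Rightarrow> ('a \<Rightarrow> 'b) list rel" where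
  "homotopic G H f g =
    {(\<alpha>, \<beta>). \<exists>n. \<alpha> \<in> homotopies_len G H f g n \<and> \<beta> \<in> homotopies_len G H f g n \<and>
       (\<alpha>, \<beta>) \<in> (htpy_step G H f g n)\<^sup>*}"

lemma equiv_homotopic: "equiv (homotopies G H f g) (homotopic G H f g)"
proof (rule equivI)
  show "homotopic G H f g \<subseteq> homotopies G H f g \<times> homotopies G H f g"
    by (auto simp: homotopic_def homotopies_def)
  show "refl_on (homotopies G H f g) (homotopic G H f g)"
    by (auto simp: refl_on_def homotopic_def homotopies_def)
  have "sym (htpy_step G H f g n)" for n
    unfolding sym_def htpy_step_def
    by clarsimp (metis adj_sym)
  then have "sym ((htpy_step G H f g n)\<^sup>*)" for n
    by (rule sym_rtrancl)
  then show "sym (homotopic G H f g)"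
    unfolding homotopic_def by (auto intro!: symI dest: symD)
  show "trans (homotopic G H f g)"
  proof (rule transI)
    fix \<alpha> \<beta> \<gamma> assume "(\<alpha>, \<beta>) \<in> homotopic G H f g" "(\<beta>, \<gamma>) \<in> homotopic G H f g"
    then obtain m n where
      m: "\<alpha> \<in> homotopies_len G H f g m" "\<beta> \<in> homotopies_len G H f g m"
         "(\<alpha>, \<beta>) \<in> (htpy_step G H f g m)\<^sup>*" and
      n: "\<beta> \<in> homotopies_len G H f g n" "\<gamma> \<in> homotopies_len G H f g n"
         "(\<beta>, \<gamma>) \<in> (htpy_step G H f g n)\<^sup>*"
      unfolding homotopic_def by blast
    have "m = n" using m(2) n(1) by (simp add: homotopies_len_def)
    then show "(\<alpha>, \<gamma>) \<in> homotopic G H f g"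
      using m n unfolding homotopic_def by (auto intro: rtrancl_trans)
  qed
qed

definition htpy_class ::
    "'a ugraph \<Rightarrow> 'b ugraph \<Rightarrow> ('a \<Rightarrow> 'b) \<Rightarrow> ('a \<Rightarrow> 'b) \<Rightarrow> ('a \<Rightarrow> 'b) list \<Rightarrow> ('a \<Rightarrow> 'b) list set" where
  "htpy_class G H f g \<alpha> = homotopic G H f g `` {\<alpha>}"

definition htpy_classes ::
    "'a ugraph \<Rightarrow> 'b ugraph \<Rightarrow> ('a \<Rightarrow> 'b) \<Rightarrow> ('a \<Rightarrow> 'b) \<Rightarrow> ('a \<Rightarrow> 'b) list set set" where
  "htpy_classes G H f g = homotopies G H f g // homotopic G H f g"

definition concat_htpy :: "('a \<Rightarrow> 'b) list \<Rightarrow> ('a \<Rightarrow> 'b) list \<Rightarrow> ('a \<Rightarrow> 'b) list" where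
  "concat_htpy \<alpha> \<beta> = \<alpha> @ tl \<beta>"

text \<open>In both whiskerings the first argument is the source graph of the composites:
  \<open>g \<alpha>\<close> for \<open>\<alpha>\<close> a homotopy of maps out of \<open>G\<close>, and \<open>\<beta> e\<close> for \<open>e\<close> a map out of \<open>G\<close>.\<close>

definition post_whisker ::
    "'a ugraph \<Rightarrow> ('b \<Rightarrow> 'c) \<Rightarrow> ('a \<Rightarrow> 'b) list \<Rightarrow> ('a \<Rightarrow> 'c) list" where
  "post_whisker G g \<alpha> = map (\<lambda>f. compose (verts G) g f) \<alpha>"

definition pre_whisker ::
    "'a ugraph \<Rightarrow> ('b \<Rightarrow> 'c) list \<Rightarrow> ('a \<Rightarrow> 'b) \<Rightarrow> ('a \<Rightarrow> 'c) list" where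
  "pre_whisker G \<beta> e = map (\<lambda>g. compose (verts G) g e) \<beta>"

definition hcomp_htpy ::
    "'a ugraph \<Rightarrow> ('a \<Rightarrow> 'b) \<Rightarrow> ('b \<Rightarrow> 'c) \<Rightarrow> ('a \<Rightarrow> 'b) list \<Rightarrow> ('b \<Rightarrow> 'c) list \<Rightarrow> ('a \<Rightarrow> 'c) list" where
  "hcomp_htpy G f' g \<alpha> \<beta> = concat_htpy (post_whisker G g \<alpha>) (pre_whisker G \<beta> f')"


section \<open>Strict 2-categories\<close>

text \<open>\<open>Hom A B\<close> is the set of 1-cells from \<open>A\<close> to \<open>B\<close>, and \<open>Cell A B f g\<close> the set of 2-cells
  from \<open>f\<close> to \<open>g\<close>, where \<open>f, g \<in> Hom A B\<close>.  These sets need not be disjoint, so the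
  compositions carry the boundary data as arguments.  All compositions are in diagrammatic
  order, the first factor being the one applied first.\<close>

locale two_category =
  fixes Obj :: "'o set"
    and Hom :: "'o \<Rightarrow> 'o \<Rightarrow> 'm set"
    and Cell :: "'o \<Rightarrow> 'o \<Rightarrow> 'm \<Rightarrow> 'm \<Rightarrow> 'c set"
    and id1 :: "'o \<Rightarrow> 'm"
    and comp1 :: "'o \<Rightarrow> 'o \<Rightarrow> 'o \<Rightarrow> 'm \<Rightarrow> 'm \<Rightarrow> 'm"
    and id2 :: "'o \<Rightarrow> 'o \<Rightarrow> 'm \<Rightarrow> 'c"
    and vcomp :: "'o \<Rightarrow> 'o \<Rightarrow> 'm \<Rightarrow> 'm \<Rightarrow> 'm \<Rightarrow> 'c \<Rightarrow> 'c \<Rightarrow> 'c"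
    and hcomp :: "'o \<Rightarrow> 'o \<Rightarrow> 'o \<Rightarrow> 'm \<Rightarrow> 'm \<Rightarrow> 'm \<Rightarrow> 'm \<Rightarrow> 'c \<Rightarrow> 'c \<Rightarrow> 'c"
  assumes id1_in: "A \<in> Obj \<Longrightarrow> id1 A \<in> Hom A A"
    and comp1_in:
      "\<lbrakk>A \<in> Obj; B \<in> Obj; C \<in> Obj; f \<in> Hom A B; g \<in> Hom B C\<rbrakk> \<Longrightarrow> comp1 A B C f g \<in> Hom A C"
    and comp1_id_left: "\<lbrakk>A \<in> Obj; B \<in> Obj; f \<in> Hom A B\<rbrakk> \<Longrightarrow> comp1 A A B (id1 A) f = f"
    and comp1_id_right: "\<lbrakk>A \<in> Obj; B \<in> Obj; f \<in> Hom A B\<rbrakk> \<Longrightarrow> comp1 A B B f (id1 B) = f"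
    and comp1_assoc:
      "\<lbrakk>A \<in> Obj; B \<in> Obj; C \<in> Obj; D \<in> Obj; f \<in> Hom A B; g \<in> Hom B C; h \<in> Hom C D\<rbrakk> \<Longrightarrow>
        comp1 A C D (comp1 A B C f g) h = comp1 A B D f (comp1 B C D g h)"
    and id2_in: "\<lbrakk>A \<in> Obj; B \<in> Obj; f \<in> Hom A B\<rbrakk> \<Longrightarrow> id2 A B f \<in> Cell A B f f"
    and vcomp_in:
      "\<lbrakk>A \<in> Obj; B \<in> Obj; f \<in> Hom A B; g \<in> Hom A B; h \<in> Hom A B;
        x \<in> Cell A B f g; y \<in> Cell A B g h\<rbrakk> \<Longrightarrow> vcomp A B f g h x y \<in> Cell A B f h"
    and vcomp_id_left:
      "\<lbrakk>A \<in> Obj; B \<in> Obj; f \<in> Hom A B; g \<in> Hom A B; x \<in> Cell A B f g\<rbrakk> \<Longrightarrow>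
        vcomp A B f f g (id2 A B f) x = x"
    and vcomp_id_right:
      "\<lbrakk>A \<in> Obj; B \<in> Obj; f \<in> Hom A B; g \<in> Hom A B; x \<in> Cell A B f g\<rbrakk> \<Longrightarrow>
        vcomp A B f g g x (id2 A B g) = x"
    and vcomp_assoc:
      "\<lbrakk>A \<in> Obj; B \<in> Obj; f \<in> Hom A B; g \<in> Hom A B; h \<in> Hom A B; k \<in> Hom A B;
        x \<in> Cell A B f g; y \<in> Cell A B g h; z \<in> Cell A B h k\<rbrakk> \<Longrightarrow>
        vcomp A B f h k (vcomp A B f g h x y) z = vcomp A B f g k x (vcomp A B g h k y z)"
    and hcomp_in:
      "\<lbrakk>A \<in> Obj; B \<in> Obj; C \<in> Obj; f \<in> Hom A B; f' \<in> Hom A B; g \<in> Hom B C; g' \<in> Hom B C;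
        x \<in> Cell A B f f'; y \<in> Cell B C g g'\<rbrakk> \<Longrightarrow>
        hcomp A B C f f' g g' x y \<in> Cell A C (comp1 A B C f g) (comp1 A B C f' g')"
    and hcomp_id_left:
      "\<lbrakk>A \<in> Obj; B \<in> Obj; f \<in> Hom A B; f' \<in> Hom A B; x \<in> Cell A B f f'\<rbrakk> \<Longrightarrow>
        hcomp A A B (id1 A) (id1 A) f f' (id2 A A (id1 A)) x = x"
    and hcomp_id_right:
      "\<lbrakk>A \<in> Obj; B \<in> Obj; f \<in> Hom A B; f' \<in> Hom A B; x \<in> Cell A B f f'\<rbrakk> \<Longrightarrow>
        hcomp A B B f f' (id1 B) (id1 B) x (id2 B B (id1 B)) = x"
    and hcomp_assoc:
      "\<lbrakk>A \<in> Obj; B \<in> Obj; C \<in> Obj; D \<in> Obj; f \<in> Hom A B; f' \<in> Hom A B;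
        g \<in> Hom B C; g' \<in> Hom B C; h \<in> Hom C D; h' \<in> Hom C D;
        x \<in> Cell A B f f'; y \<in> Cell B C g g'; z \<in> Cell C D h h'\<rbrakk> \<Longrightarrow>
        hcomp A C D (comp1 A B C f g) (comp1 A B C f' g') h h' (hcomp A B C f f' g g' x y) z =
        hcomp A B D f f' (comp1 B C D g h) (comp1 B C D g' h') x (hcomp B C D g g' h h' y z)"
    and hcomp_id2:
      "\<lbrakk>A \<in> Obj; B \<in> Obj; C \<in> Obj; f \<in> Hom A B; g \<in> Hom B C\<rbrakk> \<Longrightarrow>
        hcomp A B C f f g g (id2 A B f) (id2 B C g) = id2 A C (comp1 A B C f g)"
    and interchange:
      "\<lbrakk>A \<in> Obj; B \<in> Obj; C \<in> Obj; f \<in> Hom A B; f' \<in> Hom A B; f'' \<in> Hom A B;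
        g \<in> Hom B C; g' \<in> Hom B C; g'' \<in> Hom B C;
        x \<in> Cell A B f f'; x' \<in> Cell A B f' f''; y \<in> Cell B C g g'; y' \<in> Cell B C g' g''\<rbrakk> \<Longrightarrow>
        hcomp A B C f f'' g g'' (vcomp A B f f' f'' x x') (vcomp B C g g' g'' y y') =
        vcomp A C (comp1 A B C f g) (comp1 A B C f' g') (comp1 A B C f'' g'')
          (hcomp A B C f f' g g' x y) (hcomp A B C f' f'' g' g'' x' y')"


section \<open>The 2-category data\<close>

definition graph_comp ::
    "'a ugraph \<Rightarrow> 'b ugraph \<Rightarrow> 'c ugraph \<Rightarrow> ('a \<Rightarrow> 'b) \<Rightarrow> ('b \<Rightarrow> 'c) \<Rightarrow> 'a \<Rightarrow> 'c" where
  "graph_comp G H K f g = compose (verts G) g f"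

definition graph_id2 ::
    "'a ugraph \<Rightarrow> 'b ugraph \<Rightarrow> ('a \<Rightarrow> 'b) \<Rightarrow> ('a \<Rightarrow> 'b) list set" where
  "graph_id2 G H f = htpy_class G H f f [f]"

text \<open>Operations on classes: the union of the classes obtained from all choices of
  representatives.  This is a single class exactly when the operation is well defined.\<close>

definition graph_vcomp ::
    "'a ugraph \<Rightarrow> 'b ugraph \<Rightarrow> ('a \<Rightarrow> 'b) \<Rightarrow> ('a \<Rightarrow> 'b) \<Rightarrow> ('a \<Rightarrow> 'b) \<Rightarrow>
     ('a \<Rightarrow> 'b) list set \<Rightarrow> ('a \<Rightarrow> 'b) list set \<Rightarrow> ('a \<Rightarrow> 'b) list set" where
  "graph_vcomp G H f f' f'' X Y =
    (\<Union>\<alpha>\<in>X. \<Union>\<beta>\<in>Y. htpy_class G H f f'' (concat_htpy \<alpha> \<beta>))"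

definition graph_hcomp ::
    "'a ugraph \<Rightarrow> 'b ugraph \<Rightarrow> 'c ugraph \<Rightarrow> ('a \<Rightarrow> 'b) \<Rightarrow> ('a \<Rightarrow> 'b) \<Rightarrow> ('b \<Rightarrow> 'c) \<Rightarrow> ('b \<Rightarrow> 'c) \<Rightarrow>
     ('a \<Rightarrow> 'b) list set \<Rightarrow> ('b \<Rightarrow> 'c) list set \<Rightarrow> ('a \<Rightarrow> 'c) list set" where
  "graph_hcomp G H K f f' g g' X Y =
    (\<Union>\<alpha>\<in>X. \<Union>\<beta>\<in>Y. htpy_class G K (graph_comp G H K f g) (graph_comp G H K f' g')
                       (hcomp_htpy G f' g \<alpha> \<beta>))"

end

(* Everything except interchange already holds for the underlying lists of morphisms.  For
   interchange, homotopies alpha : f => f' and beta : g => g' span a grid of morphisms beta_j alpha_i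
   in which all grid points at Chebyshev distance at most 1 are adjacent, so the two monotone
   boundary paths are related by flipping one unit square at a time; each flip keeps the length
   and is a single step of the homotopy relation. *)

theory Submission
  imports Defs
begin

section \<open>Exponential graphs and composition\<close>

text \<open>Homotopic lists have equal length, so a homotopy cannot be padded or shortened by
  constant stretches within its class. Hence the identity 2-cell on f is the class of
  \<open>[f]\<close>, a homotopy of length 0, and every comparison has to keep the number of steps;
  both boundary paths of an n by m grid have n + m steps. The adjacency of diagonal neighbours in
  the grid comes from composition preserving adjacency in both variables at once. With one variable
  held at a morphism, which is a looped vertex of the exponential graph, the same fact gives both
  whiskerings. The two sides of interchange share the outer factors g \<alpha> and \<beta>' f'' and
  differ only in the middle, g \<alpha>' * \<beta> f'' against \<beta> f' * g' \<alpha>', so a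
  single rectangle has to be swept. The sweep is done by two inductions, over the edges of \<beta>
  with a strip for each edge, and over the edges of \<alpha> inside a strip. No coordinates of
  lattice paths are needed: pasting rectangles uses only associativity of concatenation and its
  compatibility with homotopy.\<close>

lemma adj_in_verts:
  assumes "is_graph G" "adj G v w"
  shows "v \<in> verts G" "w \<in> verts G"
  using assms unfolding is_graph_def adj_def by force+

text \<open>Turns membership in \<open>hom\<close> into one more adjacency, so that statements about
  adjacent pairs of maps specialise to morphisms.\<close>

lemma adj_exp_graph_refl_iff: "adj (exp_graph H G) f f \<longleftrightarrow> f \<in> hom G H"
  by (auto simp: adj_exp_graph hom_def)

text \<open>An edge v - w of G goes to f v - f' w in H and then to g (f v) - g' (f' w) in K. That G
  is a graph puts v and w into \<open>verts G\<close>, where \<open>compose\<close> takes its proper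
  value instead of \<open>undefined\<close>.\<close>

lemma adj_exp_graph_compose:
  assumes "is_graph G" "adj (exp_graph H G) f f'" "adj (exp_graph K H) g g'"
  shows "adj (exp_graph K G) (compose (verts G) g f) (compose (verts G) g' f')"
  using assms adj_in_verts[OF assms(1)]
  by (auto simp: adj_exp_graph compose_def)

lemma compose_in_hom:
  assumes "is_graph G" "f \<in> hom G H" "g \<in> hom H K"
  shows "compose (verts G) g f \<in> hom G K"
  using adj_exp_graph_compose[OF assms(1)] assms(2,3) by (metis adj_exp_graph_refl_iff)

lemma id_hom_in_hom: "is_graph G \<Longrightarrow> id_hom G \<in> hom G G"
  using adj_in_verts[of G] by (auto simp: hom_def id_hom_def)

lemma compose_id_hom:
  assumes "f \<in> hom G H"
  shows "compose (verts G) f (id_hom G) = f" "compose (verts G) (id_hom H) f = f"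
  using assms by (auto simp: hom_def id_hom_def compose_def restrict_def PiE_def Pi_def
      extensional_def fun_eq_iff)

lemma compose_hom_assoc:
  "f \<in> hom G H \<Longrightarrow>
    compose (verts G) (compose (verts H) h g) f = compose (verts G) h (compose (verts G) g f)"
  by (rule compose_assoc[symmetric]) (auto simp: hom_def)

section \<open>Concatenation\<close>

lemma concat_htpy_assoc:
  "\<beta> \<noteq> [] \<Longrightarrow> concat_htpy \<alpha> (concat_htpy \<beta> \<gamma>) = concat_htpy (concat_htpy \<alpha> \<beta>) \<gamma>"
  by (simp add: concat_htpy_def)

lemma concat_htpy_eq_Nil_iff: "concat_htpy \<alpha> \<beta> = [] \<longleftrightarrow> \<alpha> = [] \<and> tl \<beta> = []"
  by (simp add: concat_htpy_def)

lemma map_concat_htpy: "map F (concat_htpy \<alpha> \<beta>) = concat_htpy (map F \<alpha>) (map F \<beta>)"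
  by (simp add: concat_htpy_def map_tl)

lemma concat_htpy_singleton_right: "concat_htpy \<alpha> [f] = \<alpha>"
  by (simp add: concat_htpy_def)

lemma concat_htpy_singleton_left: "\<alpha> \<noteq> [] \<Longrightarrow> \<alpha> ! 0 = f \<Longrightarrow> concat_htpy [f] \<alpha> = \<alpha>"
  by (cases \<alpha>) (auto simp: concat_htpy_def)

lemma length_concat_htpy:
  "length \<alpha> = Suc n \<Longrightarrow> length \<beta> = Suc m \<Longrightarrow> length (concat_htpy \<alpha> \<beta>) = Suc (n + m)"
  by (simp add: concat_htpy_def)

lemma nth_concat_htpy_left: "length \<alpha> = Suc n \<Longrightarrow> i \<le> n \<Longrightarrow> concat_htpy \<alpha> \<beta> ! i = \<alpha> ! i"
  by (simp add: concat_htpy_def nth_append)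

lemma nth_concat_htpy_right:
  assumes "length \<alpha> = Suc n" "length \<beta> = Suc m" "\<alpha> ! n = \<beta> ! 0" "n \<le> i" "i \<le> n + m"
  shows "concat_htpy \<alpha> \<beta> ! i = \<beta> ! (i - n)"
\<comment> \<open>The index n is shared: its entry is stored as the last one of \<alpha>, the head
  of \<beta> having been dropped, and the matching endpoints identify the two.\<close>
proof (cases "i = n")
  case False
  then obtain k where "i = Suc (n + k)" using assms(4) by (metis less_natE le_neq_implies_less)
  then show ?thesis using assms
    by (simp add: concat_htpy_def nth_append nth_tl)
qed (use assms in \<open>simp add: nth_concat_htpy_left\<close>)

text \<open>Taking \<open>\<alpha> = \<alpha>'\<close> and \<open>\<beta> = \<beta>'\<close> gives that a concatenation is again a homotopy.\<close>

lemma adj_concat_htpy: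
  assumes len: "length \<alpha> = Suc n" "length \<alpha>' = Suc n" "length \<beta> = Suc m" "length \<beta>' = Suc m"
    and join: "\<alpha> ! n = \<beta> ! 0" "\<alpha>' ! n = \<beta>' ! 0"
    and \<alpha>: "\<forall>i i'. adj (looped_path n) i i' \<longrightarrow> adj E (\<alpha> ! i) (\<alpha>' ! i')"
    and \<beta>: "\<forall>i i'. adj (looped_path m) i i' \<longrightarrow> adj E (\<beta> ! i) (\<beta>' ! i')"
    and ii': "adj (looped_path (n + m)) i i'"
  shows "adj E (concat_htpy \<alpha> \<beta> ! i) (concat_htpy \<alpha>' \<beta>' ! i')"
proof (cases "i \<le> n \<and> i' \<le> n")
  case True
  then show ?thesis
    using \<alpha> ii' len by (simp add: nth_concat_htpy_left adj_looped_path)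
next
  case False
  \<comment> \<open>One index exceeds n, and adjacent indices differ by at most 1, so the other is
    at least n. Hence the pair lies entirely in the second half.\<close>
  then have "n \<le> i" "n \<le> i'" "i \<le> n + m" "i' \<le> n + m" "adj (looped_path m) (i - n) (i' - n)"
    using ii' by (auto simp: adj_looped_path)
  then show ?thesis
    using \<beta> len join by (simp add: nth_concat_htpy_right)
qed

section \<open>Homotopies\<close>

text \<open>The loops i - i of the path absorb the condition that each entry is a morphism. What
  remains has the shape of the condition in \<open>htpy_step\<close> with both lists equal, so one
  adjacency argument serves homotopies and steps alike.\<close>

lemma homotopies_len_adj_iff:
  "\<alpha> \<in> homotopies_len G H f g n \<longleftrightarrow>
     length \<alpha> = Suc n \<and> \<alpha> ! 0 = f \<and> \<alpha> ! n = g \<and>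
     (\<forall>i i'. adj (looped_path n) i i' \<longrightarrow> adj (exp_graph H G) (\<alpha> ! i) (\<alpha> ! i'))"
  unfolding homotopies_len_iff adj_exp_graph_refl_iff[symmetric]
  using adj_sym[of "exp_graph H G"]
  by (auto simp: adj_looped_path Suc_le_eq)

lemma homotopiesE:
  assumes "\<alpha> \<in> homotopies G H f g"
  obtains n where "\<alpha> \<in> homotopies_len G H f g n"
  using assms by (auto simp: homotopies_def)

lemma homotopies_len_subset: "\<alpha> \<in> homotopies_len G H f g n \<Longrightarrow> \<alpha> \<in> homotopies G H f g"
  by (auto simp: homotopies_def)

lemma homotopies_not_Nil: "\<alpha> \<in> homotopies G H f g \<Longrightarrow> \<alpha> \<noteq> []"
  by (auto simp: homotopies_def homotopies_len_iff)

lemma homotopies_nth_0: "\<alpha> \<in> homotopies G H f g \<Longrightarrow> \<alpha> ! 0 = f"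
  by (auto simp: homotopies_def homotopies_len_iff)

lemma homotopies_subset_hom: "\<alpha> \<in> homotopies G H f g \<Longrightarrow> h \<in> set \<alpha> \<Longrightarrow> h \<in> hom G H"
  by (auto simp: homotopies_def homotopies_len_iff in_set_conv_nth less_Suc_eq_le)

lemma homotopies_ends_in_hom:
  "\<alpha> \<in> homotopies G H f g \<Longrightarrow> f \<in> hom G H \<and> g \<in> hom G H"
  by (force simp: homotopies_def homotopies_len_iff)

lemma homotopies_singleton_iff:
  "[h] \<in> homotopies G H f g \<longleftrightarrow> h = f \<and> h = g \<and> h \<in> hom G H"
  by (auto simp: homotopies_def homotopies_len_iff)

lemma homotopies_Cons_Cons_iff:
  "h # k # \<alpha> \<in> homotopies G H f g \<longleftrightarrow>
     h = f \<and> h \<in> hom G H \<and> adj (exp_graph H G) h k \<and> k # \<alpha> \<in> homotopies G H k g"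
proof -
  have eq: "(\<forall>i\<le>Suc n. P i) \<longleftrightarrow> P 0 \<and> (\<forall>i\<le>n. P (Suc i))" for P and n :: nat
    by (metis Suc_le_mono le0 not0_implies_Suc)
  have less: "(\<forall>i<Suc n. P i) \<longleftrightarrow> P 0 \<and> (\<forall>i<n. P (Suc i))" for P and n :: nat
    by (metis less_Suc_eq_0_disj)
  show ?thesis
    by (simp add: homotopies_def homotopies_len_iff eq less) blast
qed

text \<open>Splits off the first edge while the target g stays fixed. The step is phrased as a
  concatenation with \<open>[f, h]\<close> rather than with \<open>#\<close>, so that the pasting
  lemmas for concatenations apply directly.\<close>

lemma homotopies_induct [consumes 1, case_names singleton Cons]:
  assumes "\<alpha> \<in> homotopies G H f g"
    and "g \<in> hom G H \<Longrightarrow> P g [g]"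
    and "\<And>f h \<alpha>. \<lbrakk>f \<in> hom G H; adj (exp_graph H G) f h; \<alpha> \<in> homotopies G H h g; P h \<alpha>\<rbrakk>
           \<Longrightarrow> P f (concat_htpy [f, h] \<alpha>)"
  shows "P f \<alpha>"
  using assms(1)
proof (induction \<alpha> arbitrary: f rule: induct_list012)
  case 1
  then show ?case using homotopies_not_Nil by blast
next
  case (2 h)
  then show ?case using assms(2) by (auto simp: homotopies_singleton_iff)
next
  case (3 h k \<alpha>)
  then show ?case
    using assms(3)[of h k "k # \<alpha>"] by (auto simp: homotopies_Cons_Cons_iff concat_htpy_def)
qed

lemma concat_htpy_in_homotopies_len:
  assumes "\<alpha> \<in> homotopies_len G H f f' n" "\<beta> \<in> homotopies_len G H f' f'' m"
  shows "concat_htpy \<alpha> \<beta> \<in> homotopies_len G H f f'' (n + m)"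
  using assms adj_concat_htpy[of \<alpha> n \<alpha> \<beta> m \<beta> "exp_graph H G"]
  by (auto simp: homotopies_len_adj_iff length_concat_htpy nth_concat_htpy_left
      nth_concat_htpy_right)

lemma concat_htpy_in_homotopies:
  "\<alpha> \<in> homotopies G H f f' \<Longrightarrow> \<beta> \<in> homotopies G H f' f'' \<Longrightarrow>
    concat_htpy \<alpha> \<beta> \<in> homotopies G H f f''"
  by (meson concat_htpy_in_homotopies_len homotopiesE homotopies_len_subset)

lemma htpy_step_concat:
  assumes "(\<alpha>, \<alpha>') \<in> htpy_step G H f f' n" "(\<beta>, \<beta>') \<in> htpy_step G H f' f'' m"
  shows "(concat_htpy \<alpha> \<beta>, concat_htpy \<alpha>' \<beta>') \<in> htpy_step G H f f'' (n + m)"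
  using assms adj_concat_htpy[of \<alpha> n \<alpha>' \<beta> m \<beta>' "exp_graph H G"]
  unfolding htpy_step_def
  by (auto simp: concat_htpy_in_homotopies_len) (auto simp: homotopies_len_adj_iff)

lemma htpy_step_refl: "\<alpha> \<in> homotopies_len G H f g n \<Longrightarrow> (\<alpha>, \<alpha>) \<in> htpy_step G H f g n"
  by (auto simp: htpy_step_def homotopies_len_adj_iff)

lemma htpy_step_imp_homotopic:
  "(\<alpha>, \<beta>) \<in> htpy_step G H f g n \<Longrightarrow> (\<alpha>, \<beta>) \<in> homotopic G H f g"
  unfolding homotopic_def by (auto simp: htpy_step_def)

lemma homotopic_refl: "\<alpha> \<in> homotopies G H f g \<Longrightarrow> (\<alpha>, \<alpha>) \<in> homotopic G H f g"
  by (meson equiv_homotopic equivE refl_onD)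

lemma homotopic_trans [trans]:
  "(\<alpha>, \<beta>) \<in> homotopic G H f g \<Longrightarrow> (\<beta>, \<gamma>) \<in> homotopic G H f g \<Longrightarrow>
    (\<alpha>, \<gamma>) \<in> homotopic G H f g"
  by (meson equiv_homotopic equivE transD)

lemma homotopic_in_homotopies:
  "(\<alpha>, \<beta>) \<in> homotopic G H f g \<Longrightarrow> \<alpha> \<in> homotopies G H f g \<and> \<beta> \<in> homotopies G H f g"
  by (auto simp: homotopic_def homotopies_def)

text \<open>A map of lists that preserves single steps preserves chains of them. Reflexive steps
  cover the empty chain, so no separate assumption that T sends homotopies to homotopies is
  required.\<close>

lemma homotopic_of_steps:
  assumes "(\<alpha>, \<beta>) \<in> homotopic G H f g"
    and step: "\<And>n \<alpha> \<beta>. (\<alpha>, \<beta>) \<in> htpy_step G H f g n \<Longrightarrow>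
                 (T \<alpha>, T \<beta>) \<in> htpy_step G' H' f' g' (t n)"
  shows "(T \<alpha>, T \<beta>) \<in> homotopic G' H' f' g'"
proof -
  obtain n where n: "\<alpha> \<in> homotopies_len G H f g n" "(\<alpha>, \<beta>) \<in> (htpy_step G H f g n)\<^sup>*"
    using assms(1) by (auto simp: homotopic_def)
  from n(2) show ?thesis
  proof induction
    case base
    show ?case using htpy_step_imp_homotopic[OF step[OF htpy_step_refl[OF n(1)]]] .
  next
    case (step \<beta> \<gamma>)
    then show ?case
      using htpy_step_imp_homotopic[OF assms(2)] homotopic_trans by blast
  qed
qed

lemma homotopic_concat:
  assumes "(\<alpha>, \<alpha>') \<in> homotopic G H f f'" "(\<beta>, \<beta>') \<in> homotopic G H f' f''"
  shows "(concat_htpy \<alpha> \<beta>, concat_htpy \<alpha>' \<beta>') \<in> homotopic G H f f''"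
proof -
  obtain m where m: "\<beta> \<in> homotopies_len G H f' f'' m"
    using assms(2) by (auto simp: homotopic_def)
  obtain n where n: "\<alpha>' \<in> homotopies_len G H f f' n"
    using assms(1) by (auto simp: homotopic_def)
  \<comment> \<open>The chains for the two factors may have different numbers of steps, so one
    factor is moved at a time while the other rests at a reflexive step.\<close>
  have "(concat_htpy \<alpha> \<beta>, concat_htpy \<alpha>' \<beta>) \<in> homotopic G H f f''"
    by (rule homotopic_of_steps[OF assms(1), where T = "\<lambda>\<alpha>. concat_htpy \<alpha> \<beta>"])
      (rule htpy_step_concat[OF _ htpy_step_refl[OF m]])
  also have "(concat_htpy \<alpha>' \<beta>, concat_htpy \<alpha>' \<beta>') \<in> homotopic G H f f''"
    by (rule homotopic_of_steps[OF assms(2)])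
      (rule htpy_step_concat[OF htpy_step_refl[OF n]])
  finally show ?thesis .
qed

section \<open>Whiskering\<close>

text \<open>Common core of the two whiskerings: F plays the role of a graph morphism between
  exponential graphs, applied to every entry of the list.\<close>

lemma map_in_homotopies:
  assumes "\<alpha> \<in> homotopies G H f g"
    and "\<And>h h'. adj (exp_graph H G) h h' \<Longrightarrow> adj (exp_graph H' G') (F h) (F h')"
  shows "map F \<alpha> \<in> homotopies G' H' (F f) (F g)"
proof -
  obtain n where "\<alpha> \<in> homotopies_len G H f g n" using assms(1) by (rule homotopiesE)
  then have "map F \<alpha> \<in> homotopies_len G' H' (F f) (F g) n"
    using assms(2) by (auto simp: homotopies_len_adj_iff adj_looped_path)
  then show ?thesis by (rule homotopies_len_subset)
qed

lemma homotopic_map: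
  assumes "(\<alpha>, \<beta>) \<in> homotopic G H f g"
    and "\<And>h h'. adj (exp_graph H G) h h' \<Longrightarrow> adj (exp_graph H' G') (F h) (F h')"
  shows "(map F \<alpha>, map F \<beta>) \<in> homotopic G' H' (F f) (F g)"
  using assms(1)
proof (rule homotopic_of_steps)
  show "(map F \<alpha>, map F \<beta>) \<in> htpy_step G' H' (F f) (F g) n"
    if "(\<alpha>, \<beta>) \<in> htpy_step G H f g n" for n \<alpha> \<beta>
    using that assms(2) by (auto simp: htpy_step_def homotopies_len_adj_iff adj_looped_path)
qed

context
  fixes G :: "'a ugraph" and H :: "'b ugraph" and K :: "'c ugraph"
  assumes G: "is_graph G"
begin

lemma post_whisker_in_homotopies:
  assumes "\<alpha> \<in> homotopies G H f f'" "g \<in> hom H K"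
  shows "post_whisker G g \<alpha> \<in> homotopies G K (compose (verts G) g f) (compose (verts G) g f')"
  unfolding post_whisker_def using assms(1)
  by (rule map_in_homotopies)
    (simp add: adj_exp_graph_compose[OF G] adj_exp_graph_refl_iff assms(2))

lemma pre_whisker_in_homotopies:
  assumes "\<beta> \<in> homotopies H K g g'" "f \<in> hom G H"
  shows "pre_whisker G \<beta> f \<in> homotopies G K (compose (verts G) g f) (compose (verts G) g' f)"
  unfolding pre_whisker_def using assms(1)
  by (rule map_in_homotopies[where F = "\<lambda>g. compose (verts G) g f"])
    (simp add: adj_exp_graph_compose[OF G, of H] adj_exp_graph_refl_iff assms(2))

lemma homotopic_post_whisker:
  assumes "(\<alpha>, \<alpha>') \<in> homotopic G H f f'" "g \<in> hom H K"
  shows "(post_whisker G g \<alpha>, post_whisker G g \<alpha>')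
           \<in> homotopic G K (compose (verts G) g f) (compose (verts G) g f')"
  unfolding post_whisker_def using assms(1)
  by (rule homotopic_map)
    (simp add: adj_exp_graph_compose[OF G] adj_exp_graph_refl_iff assms(2))

lemma homotopic_pre_whisker:
  assumes "(\<beta>, \<beta>') \<in> homotopic H K g g'" "f \<in> hom G H"
  shows "(pre_whisker G \<beta> f, pre_whisker G \<beta>' f)
           \<in> homotopic G K (compose (verts G) g f) (compose (verts G) g' f)"
  unfolding pre_whisker_def using assms(1)
  by (rule homotopic_map[where F = "\<lambda>g. compose (verts G) g f"])
    (simp add: adj_exp_graph_compose[OF G, of H] adj_exp_graph_refl_iff assms(2))

lemma hcomp_htpy_in_homotopies:
  assumes "\<alpha> \<in> homotopies G H f f'" "\<beta> \<in> homotopies H K g g'"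
  shows "hcomp_htpy G f' g \<alpha> \<beta>
           \<in> homotopies G K (compose (verts G) g f) (compose (verts G) g' f')"
  unfolding hcomp_htpy_def
  using assms homotopies_ends_in_hom[OF assms(1)] homotopies_ends_in_hom[OF assms(2)]
  by (blast intro: concat_htpy_in_homotopies post_whisker_in_homotopies pre_whisker_in_homotopies)

lemma homotopic_hcomp:
  assumes "(\<alpha>, \<alpha>') \<in> homotopic G H f f'" "(\<beta>, \<beta>') \<in> homotopic H K g g'"
  shows "(hcomp_htpy G f' g \<alpha> \<beta>, hcomp_htpy G f' g \<alpha>' \<beta>')
           \<in> homotopic G K (compose (verts G) g f) (compose (verts G) g' f')"
proof -
  have "f' \<in> hom G H" "g \<in> hom H K"
    using assms homotopic_in_homotopies homotopies_ends_in_hom by blast+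
  then show ?thesis
    unfolding hcomp_htpy_def
    using assms by (blast intro: homotopic_concat homotopic_post_whisker homotopic_pre_whisker)
qed

section \<open>Exchanging the order of the two whiskerings\<close>

text \<open>Each of {f, f'} and {g, g'} is a clique with loops, hence so is the set \<open>Q\<close>
  of the four composites. The two paths around the square therefore form one step; the essential
  case is that their middle entries, the opposite corners g f' and g' f, are adjacent.\<close>

lemma whisker_swap_square:
  assumes "adj (exp_graph H G) f f'" "adj (exp_graph K H) g g'"
    and "f \<in> hom G H" "f' \<in> hom G H" "g \<in> hom H K" "g' \<in> hom H K"
  shows "(concat_htpy (post_whisker G g [f, f']) (pre_whisker G [g, g'] f'),
          concat_htpy (pre_whisker G [g, g'] f) (post_whisker G g' [f, f']))
           \<in> homotopic G K (compose (verts G) g f) (compose (verts G) g' f')"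
proof -
  let ?c = "\<lambda>g f. compose (verts G) g f"
  let ?upper = "[?c g f, ?c g f', ?c g' f']" and ?lower = "[?c g f, ?c g' f, ?c g' f']"
  define Q where "Q = (\<lambda>(h, k). ?c h k) ` ({g, g'} \<times> {f, f'})"
  have "adj (exp_graph K H) h h'" if "h \<in> {g, g'}" "h' \<in> {g, g'}" for h h'
    using that assms(2,5,6) adj_sym[of _ g g'] by (auto simp: adj_exp_graph_refl_iff)
  moreover have "adj (exp_graph H G) k k'" if "k \<in> {f, f'}" "k' \<in> {f, f'}" for k k'
    using that assms(1,3,4) adj_sym[of _ f f'] by (auto simp: adj_exp_graph_refl_iff)
  ultimately have adj: "adj (exp_graph K G) p q" if "p \<in> Q" "q \<in> Q" for p q
    using that unfolding Q_def by (clarify, intro adj_exp_graph_compose[OF G]) blast+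
  have nth: "?upper ! i \<in> Q" "?lower ! i \<in> Q" if "i \<le> 2" for i
  proof -
    have "set ?upper \<subseteq> Q" "set ?lower \<subseteq> Q"
      unfolding Q_def by simp_all
    then show "?upper ! i \<in> Q" "?lower ! i \<in> Q"
      using that nth_mem[of i ?upper] nth_mem[of i ?lower] by (simp_all only: list.size) auto
  qed
  have "(?upper, ?lower) \<in> htpy_step G K (?c g f) (?c g' f') 2"
    unfolding htpy_step_def homotopies_len_adj_iff
    by (simp add: adj nth adj_looped_path del: nth_Cons_numeral)
  then show ?thesis
    by (simp add: htpy_step_imp_homotopic post_whisker_def pre_whisker_def concat_htpy_def)
qed

text \<open>Pastes two rectangles along their common side \<beta> f': the factor \<beta> is moved
  past \<alpha>' by \<open>swap'\<close> and then past \<alpha> by \<open>swap\<close>.\<close>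

lemma whisker_swap_concat_left:
  assumes "\<alpha> \<in> homotopies G H f f'" "\<alpha>' \<in> homotopies G H f' f''" "\<beta> \<in> homotopies H K g g'"
    and swap: "(concat_htpy (post_whisker G g \<alpha>) (pre_whisker G \<beta> f'),
             concat_htpy (pre_whisker G \<beta> f) (post_whisker G g' \<alpha>))
           \<in> homotopic G K (compose (verts G) g f) (compose (verts G) g' f')"
    and swap': "(concat_htpy (post_whisker G g \<alpha>') (pre_whisker G \<beta> f''),
             concat_htpy (pre_whisker G \<beta> f') (post_whisker G g' \<alpha>'))
           \<in> homotopic G K (compose (verts G) g f') (compose (verts G) g' f'')"
  shows "(concat_htpy (post_whisker G g (concat_htpy \<alpha> \<alpha>')) (pre_whisker G \<beta> f''),
             concat_htpy (pre_whisker G \<beta> f) (post_whisker G g' (concat_htpy \<alpha> \<alpha>')))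
           \<in> homotopic G K (compose (verts G) g f) (compose (verts G) g' f'')"
proof -
  note ne = assms(1-3)[THEN homotopies_not_Nil]
  have hom: "g \<in> hom H K" "g' \<in> hom H K"
    using homotopies_ends_in_hom[OF assms(3)] by auto
  note concat = post_whisker_def pre_whisker_def map_concat_htpy concat_htpy_assoc ne
  have "concat_htpy (post_whisker G g (concat_htpy \<alpha> \<alpha>')) (pre_whisker G \<beta> f'') =
      concat_htpy (post_whisker G g \<alpha>) (concat_htpy (post_whisker G g \<alpha>') (pre_whisker G \<beta> f''))"
    by (simp add: concat)
  also have "(\<dots>, concat_htpy (post_whisker G g \<alpha>)
        (concat_htpy (pre_whisker G \<beta> f') (post_whisker G g' \<alpha>')))
      \<in> homotopic G K (compose (verts G) g f) (compose (verts G) g' f'')"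
    by (intro homotopic_concat[OF homotopic_refl swap'] post_whisker_in_homotopies assms(1) hom)
  also have "concat_htpy (post_whisker G g \<alpha>)
        (concat_htpy (pre_whisker G \<beta> f') (post_whisker G g' \<alpha>')) =
      concat_htpy (concat_htpy (post_whisker G g \<alpha>) (pre_whisker G \<beta> f')) (post_whisker G g' \<alpha>')"
    by (simp add: concat)
  also have "(\<dots>, concat_htpy (concat_htpy (pre_whisker G \<beta> f) (post_whisker G g' \<alpha>))
        (post_whisker G g' \<alpha>'))
      \<in> homotopic G K (compose (verts G) g f) (compose (verts G) g' f'')"
    by (intro homotopic_concat[OF swap homotopic_refl] post_whisker_in_homotopies assms(2) hom)
  also have "concat_htpy (concat_htpy (pre_whisker G \<beta> f) (post_whisker G g' \<alpha>))
        (post_whisker G g' \<alpha>') =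
      concat_htpy (pre_whisker G \<beta> f) (post_whisker G g' (concat_htpy \<alpha> \<alpha>'))"
    by (simp add: concat)
  finally show ?thesis .
qed

text \<open>The pasting in the other direction, along the common side g' \<alpha>: here \<alpha> is
  moved past \<beta> and then past \<beta>'.\<close>

lemma whisker_swap_concat_right:
  assumes "\<alpha> \<in> homotopies G H f f'" "\<beta> \<in> homotopies H K g g'" "\<beta>' \<in> homotopies H K g' g''"
    and swap: "(concat_htpy (post_whisker G g \<alpha>) (pre_whisker G \<beta> f'),
             concat_htpy (pre_whisker G \<beta> f) (post_whisker G g' \<alpha>))
           \<in> homotopic G K (compose (verts G) g f) (compose (verts G) g' f')"
    and swap': "(concat_htpy (post_whisker G g' \<alpha>) (pre_whisker G \<beta>' f'),
             concat_htpy (pre_whisker G \<beta>' f) (post_whisker G g'' \<alpha>))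
           \<in> homotopic G K (compose (verts G) g' f) (compose (verts G) g'' f')"
  shows "(concat_htpy (post_whisker G g \<alpha>) (pre_whisker G (concat_htpy \<beta> \<beta>') f'),
             concat_htpy (pre_whisker G (concat_htpy \<beta> \<beta>') f) (post_whisker G g'' \<alpha>))
           \<in> homotopic G K (compose (verts G) g f) (compose (verts G) g'' f')"
proof -
  note ne = assms(1-3)[THEN homotopies_not_Nil]
  have hom: "f \<in> hom G H" "f' \<in> hom G H"
    using homotopies_ends_in_hom[OF assms(1)] by auto
  note concat = post_whisker_def pre_whisker_def map_concat_htpy concat_htpy_assoc ne
  have "concat_htpy (post_whisker G g \<alpha>) (pre_whisker G (concat_htpy \<beta> \<beta>') f') =
      concat_htpy (concat_htpy (post_whisker G g \<alpha>) (pre_whisker G \<beta> f')) (pre_whisker G \<beta>' f')"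
    by (simp add: concat)
  also have "(\<dots>, concat_htpy (concat_htpy (pre_whisker G \<beta> f) (post_whisker G g' \<alpha>))
        (pre_whisker G \<beta>' f'))
      \<in> homotopic G K (compose (verts G) g f) (compose (verts G) g'' f')"
    by (intro homotopic_concat[OF swap homotopic_refl] pre_whisker_in_homotopies assms(3) hom)
  also have "concat_htpy (concat_htpy (pre_whisker G \<beta> f) (post_whisker G g' \<alpha>))
        (pre_whisker G \<beta>' f') =
      concat_htpy (pre_whisker G \<beta> f) (concat_htpy (post_whisker G g' \<alpha>) (pre_whisker G \<beta>' f'))"
    by (simp add: concat)
  also have "(\<dots>, concat_htpy (pre_whisker G \<beta> f)
        (concat_htpy (pre_whisker G \<beta>' f) (post_whisker G g'' \<alpha>)))
      \<in> homotopic G K (compose (verts G) g f) (compose (verts G) g'' f')"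
    by (intro homotopic_concat[OF homotopic_refl swap'] pre_whisker_in_homotopies assms(2) hom)
  also have "concat_htpy (pre_whisker G \<beta> f)
        (concat_htpy (pre_whisker G \<beta>' f) (post_whisker G g'' \<alpha>)) =
      concat_htpy (pre_whisker G (concat_htpy \<beta> \<beta>') f) (post_whisker G g'' \<alpha>)"
    by (simp add: concat)
  finally show ?thesis .
qed

text \<open>A strip of height one, built from a square for each edge of \<alpha>. Over a one-entry
  \<alpha> both paths are the same list.\<close>

lemma whisker_swap_edge:
  assumes "\<alpha> \<in> homotopies G H f f'" "adj (exp_graph K H) g g'" "g \<in> hom H K" "g' \<in> hom H K"
  shows "(concat_htpy (post_whisker G g \<alpha>) (pre_whisker G [g, g'] f'),
          concat_htpy (pre_whisker G [g, g'] f) (post_whisker G g' \<alpha>))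
           \<in> homotopic G K (compose (verts G) g f) (compose (verts G) g' f')"
proof -
  have \<beta>: "[g, g'] \<in> homotopies H K g g'"
    using assms by (simp add: homotopies_Cons_Cons_iff homotopies_singleton_iff)
  show ?thesis
    using assms(1)
  proof (induction rule: homotopies_induct)
    case singleton
    then show ?case
      using pre_whisker_in_homotopies[OF \<beta>]
      by (auto simp: post_whisker_def pre_whisker_def concat_htpy_def intro!: homotopic_refl)
  next
    case (Cons f h \<alpha>)
    have h: "h \<in> hom G H" using Cons homotopies_ends_in_hom by blast
    have "[f, h] \<in> homotopies G H f h"
      using Cons h by (simp add: homotopies_Cons_Cons_iff homotopies_singleton_iff)
    then show ?case
      using Cons \<beta> h whisker_swap_square assms whisker_swap_concat_left by blast
  qed
qed

text \<open>The whole rectangle, built by stacking one strip for each edge of \<beta>. Over a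
  one-entry \<beta> both paths reduce to g' \<alpha>.\<close>

lemma whisker_swap:
  assumes "\<alpha> \<in> homotopies G H f f'" "\<beta> \<in> homotopies H K g g'"
  shows "(concat_htpy (post_whisker G g \<alpha>) (pre_whisker G \<beta> f'),
          concat_htpy (pre_whisker G \<beta> f) (post_whisker G g' \<alpha>))
           \<in> homotopic G K (compose (verts G) g f) (compose (verts G) g' f')"
  using assms(2)
proof (induction rule: homotopies_induct)
  case singleton
  have *: "post_whisker G g' \<alpha> \<in> homotopies G K (compose (verts G) g' f) (compose (verts G) g' f')"
    using post_whisker_in_homotopies[OF assms(1) singleton] .
  show ?case
    using concat_htpy_singleton_left[OF homotopies_not_Nil[OF *] homotopies_nth_0[OF *]] *
    by (simp add: pre_whisker_def concat_htpy_singleton_right homotopic_refl)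
next
  case (Cons g h \<beta>)
  have h: "h \<in> hom H K" using Cons homotopies_ends_in_hom by blast
  have "[g, h] \<in> homotopies H K g h"
    using Cons h by (simp add: homotopies_Cons_Cons_iff homotopies_singleton_iff)
  then show ?case
    using Cons h whisker_swap_edge assms(1) whisker_swap_concat_right by blast
qed

text \<open>Up to reassociation the two lists are g \<alpha> * g \<alpha>' * \<beta> f'' * \<beta>'
  f'' and g \<alpha> * \<beta> f' * g' \<alpha>' * \<beta>' f'', so \<open>whisker_swap\<close> for
  \<alpha>' and \<beta> applied in the middle suffices.\<close>

lemma hcomp_interchange:
  assumes "\<alpha> \<in> homotopies G H f f'" "\<alpha>' \<in> homotopies G H f' f''"
    and "\<beta> \<in> homotopies H K g g'" "\<beta>' \<in> homotopies H K g' g''"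
  shows "(hcomp_htpy G f'' g (concat_htpy \<alpha> \<alpha>') (concat_htpy \<beta> \<beta>'),
          concat_htpy (hcomp_htpy G f' g \<alpha> \<beta>) (hcomp_htpy G f'' g' \<alpha>' \<beta>'))
           \<in> homotopic G K (compose (verts G) g f) (compose (verts G) g'' f'')"
proof -
  note concat = post_whisker_def pre_whisker_def map_concat_htpy concat_htpy_assoc
    concat_htpy_eq_Nil_iff assms[THEN homotopies_not_Nil]
  have hom: "g \<in> hom H K" "f'' \<in> hom G H"
    using assms homotopies_ends_in_hom by blast+
  have "hcomp_htpy G f'' g (concat_htpy \<alpha> \<alpha>') (concat_htpy \<beta> \<beta>') =
      concat_htpy (post_whisker G g \<alpha>) (concat_htpy
        (concat_htpy (post_whisker G g \<alpha>') (pre_whisker G \<beta> f'')) (pre_whisker G \<beta>' f''))"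
    by (simp add: hcomp_htpy_def concat)
  also have "(\<dots>, concat_htpy (post_whisker G g \<alpha>) (concat_htpy
        (concat_htpy (pre_whisker G \<beta> f') (post_whisker G g' \<alpha>')) (pre_whisker G \<beta>' f'')))
      \<in> homotopic G K (compose (verts G) g f) (compose (verts G) g'' f'')"
    by (rule homotopic_concat[OF homotopic_refl homotopic_concat[OF whisker_swap homotopic_refl]])
      (use assms hom in \<open>auto intro: post_whisker_in_homotopies pre_whisker_in_homotopies\<close>)
  also have "concat_htpy (post_whisker G g \<alpha>) (concat_htpy
        (concat_htpy (pre_whisker G \<beta> f') (post_whisker G g' \<alpha>')) (pre_whisker G \<beta>' f'')) =
      concat_htpy (hcomp_htpy G f' g \<alpha> \<beta>) (hcomp_htpy G f'' g' \<alpha>' \<beta>')"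
    by (simp add: hcomp_htpy_def concat)
  finally show ?thesis .
qed

end

section \<open>Associativity and units of horizontal composition on representatives\<close>

text \<open>With composites of maps written as juxtaposition, both sides are the list h g \<alpha> *
  h \<beta> f' * \<gamma> g' f'. The entries of \<alpha> must be morphisms for the restrictions
  hidden in \<open>compose\<close> to agree.\<close>

lemma hcomp_htpy_assoc:
  assumes "\<alpha> \<in> homotopies G H f f'" "\<beta> \<in> homotopies H K g g'"
  shows "hcomp_htpy G (compose (verts G) g' f') h (hcomp_htpy G f' g \<alpha> \<beta>) \<gamma> =
         hcomp_htpy G f' (compose (verts H) h g) \<alpha> (hcomp_htpy H g' h \<beta> \<gamma>)"
proof -
  have "f' \<in> hom G H" using homotopies_ends_in_hom[OF assms(1)] by blast
  moreover have "map (\<lambda>f. compose (verts G) h (compose (verts G) g f)) \<alpha> =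
      map (compose (verts G) (compose (verts H) h g)) \<alpha>"
    using homotopies_subset_hom[OF assms(1)] by (simp add: compose_hom_assoc)
  ultimately show ?thesis
    using homotopies_not_Nil[OF assms(2)]
    by (simp add: hcomp_htpy_def post_whisker_def pre_whisker_def map_concat_htpy
        concat_htpy_assoc compose_hom_assoc o_def del: map_eq_conv)
qed

lemma hcomp_htpy_id_left:
  assumes "\<alpha> \<in> homotopies G H f f'"
  shows "hcomp_htpy G (id_hom G) f [id_hom G] \<alpha> = \<alpha>"
proof -
  have "map (\<lambda>g. compose (verts G) g (id_hom G)) \<alpha> = \<alpha>"
    using homotopies_subset_hom[OF assms] compose_id_hom(1) by (blast intro: map_idI)
  moreover have "compose (verts G) f (id_hom G) = f"
    using homotopies_ends_in_hom[OF assms] compose_id_hom by blast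
  ultimately show ?thesis
    using homotopies_not_Nil[OF assms] homotopies_nth_0[OF assms]
    by (simp add: hcomp_htpy_def post_whisker_def pre_whisker_def concat_htpy_singleton_left)
qed

lemma hcomp_htpy_id_right:
  assumes "\<alpha> \<in> homotopies G H f f'"
  shows "hcomp_htpy G f' (id_hom H) \<alpha> [id_hom H] = \<alpha>"
  using homotopies_subset_hom[OF assms]
  by (simp add: hcomp_htpy_def post_whisker_def pre_whisker_def concat_htpy_singleton_right
      compose_id_hom map_idI)

section \<open>Homotopy classes\<close>

lemma htpy_class_eqI:
  "(\<alpha>, \<beta>) \<in> homotopic G H f g \<Longrightarrow> htpy_class G H f g \<alpha> = htpy_class G H f g \<beta>"
  unfolding htpy_class_def using equiv_homotopic by (rule equiv_class_eq)

lemma mem_htpy_class_iff: "\<beta> \<in> htpy_class G H f g \<alpha> \<longleftrightarrow> (\<alpha>, \<beta>) \<in> homotopic G H f g"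
  by (simp add: htpy_class_def)

lemma htpy_class_in_htpy_classes:
  "\<alpha> \<in> homotopies G H f g \<Longrightarrow> htpy_class G H f g \<alpha> \<in> htpy_classes G H f g"
  by (auto simp: htpy_class_def htpy_classes_def intro: quotientI)

lemma htpy_classesE:
  assumes "X \<in> htpy_classes G H f g"
  obtains \<alpha> where "\<alpha> \<in> homotopies G H f g" "X = htpy_class G H f g \<alpha>"
  using assms by (auto simp: htpy_class_def htpy_classes_def elim: quotientE)

text \<open>This is well-definedness: by \<open>homotopic_concat\<close> the family in the union is
  constant, and since \<alpha> and \<beta> lie in their own classes the index sets are nonempty, so
  the union is that one class.\<close>

lemma graph_vcomp_htpy_class:
  assumes "\<alpha> \<in> homotopies G H f f'" "\<beta> \<in> homotopies G H f' f''"
  shows "graph_vcomp G H f f' f'' (htpy_class G H f f' \<alpha>) (htpy_class G H f' f'' \<beta>) =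
         htpy_class G H f f'' (concat_htpy \<alpha> \<beta>)"
proof -
  have "htpy_class G H f f'' (concat_htpy \<alpha>' \<beta>') = htpy_class G H f f'' (concat_htpy \<alpha> \<beta>)"
    if "\<alpha>' \<in> htpy_class G H f f' \<alpha>" "\<beta>' \<in> htpy_class G H f' f'' \<beta>" for \<alpha>' \<beta>'
    using that by (metis homotopic_concat htpy_class_eqI mem_htpy_class_iff)
  moreover have "\<alpha> \<in> htpy_class G H f f' \<alpha>" "\<beta> \<in> htpy_class G H f' f'' \<beta>"
    using assms by (simp_all add: mem_htpy_class_iff homotopic_refl)
  ultimately show ?thesis unfolding graph_vcomp_def by (intro UN_constant_eq ballI)
qed

lemma graph_hcomp_htpy_class:
  assumes "is_graph G" "\<alpha> \<in> homotopies G H f f'" "\<beta> \<in> homotopies H K g g'"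
  shows "graph_hcomp G H K f f' g g' (htpy_class G H f f' \<alpha>) (htpy_class H K g g' \<beta>) =
         htpy_class G K (compose (verts G) g f) (compose (verts G) g' f') (hcomp_htpy G f' g \<alpha> \<beta>)"
proof -
  let ?C = "htpy_class G K (compose (verts G) g f) (compose (verts G) g' f')"
  have "?C (hcomp_htpy G f' g \<alpha>' \<beta>') = ?C (hcomp_htpy G f' g \<alpha> \<beta>)"
    if "\<alpha>' \<in> htpy_class G H f f' \<alpha>" "\<beta>' \<in> htpy_class H K g g' \<beta>" for \<alpha>' \<beta>'
    using that homotopic_hcomp[OF assms(1)] by (metis htpy_class_eqI mem_htpy_class_iff)
  moreover have "\<alpha> \<in> htpy_class G H f f' \<alpha>" "\<beta> \<in> htpy_class H K g g' \<beta>"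
    using assms by (simp_all add: mem_htpy_class_iff homotopic_refl)
  ultimately show ?thesis
    unfolding graph_hcomp_def graph_comp_def by (intro UN_constant_eq ballI)
qed

text \<open>After choosing representatives, each equation between 2-cells other than interchange is
  an equality of lists. A single vertex type is used because the locale has one type of objects and
  one type of 1-cells, while the lemmas above allow different types.\<close>

lemma two_category_graphs:
  "two_category {G :: 'a ugraph. is_graph G} hom htpy_classes
     id_hom graph_comp graph_id2 graph_vcomp graph_hcomp"
proof (unfold_locales, unfold mem_Collect_eq)
  fix A B C D :: "'a ugraph" and f f' f'' g g' g'' h h' k :: "'a \<Rightarrow> 'a"
    and x x' y y' z :: "('a \<Rightarrow> 'a) list set"
  show "id_hom A \<in> hom A A" if "is_graph A"
    using that by (rule id_hom_in_hom)
  show "graph_comp A B C f g \<in> hom A C" if "is_graph A" "f \<in> hom A B" "g \<in> hom B C"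
    using that by (simp add: graph_comp_def compose_in_hom)
  show "graph_comp A A B (id_hom A) f = f" "graph_comp A B B f (id_hom B) = f" if "f \<in> hom A B"
    using that by (simp_all add: graph_comp_def compose_id_hom)
  show "graph_comp A C D (graph_comp A B C f g) h = graph_comp A B D f (graph_comp B C D g h)"
    if "f \<in> hom A B"
    using that by (simp add: graph_comp_def compose_hom_assoc)
  show "graph_id2 A B f \<in> htpy_classes A B f f" if "f \<in> hom A B"
    using that by (simp add: graph_id2_def htpy_class_in_htpy_classes homotopies_singleton_iff)
  show "graph_vcomp A B f g h x y \<in> htpy_classes A B f h"
    if "x \<in> htpy_classes A B f g" "y \<in> htpy_classes A B g h"
    using that by (auto elim!: htpy_classesE simp: graph_vcomp_htpy_class
        intro!: htpy_class_in_htpy_classes concat_htpy_in_homotopies)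
  show "graph_vcomp A B f f g (graph_id2 A B f) x = x"
    if "f \<in> hom A B" "x \<in> htpy_classes A B f g"
    using that by (auto elim!: htpy_classesE simp: graph_id2_def graph_vcomp_htpy_class
        homotopies_singleton_iff concat_htpy_singleton_left homotopies_not_Nil homotopies_nth_0)
  show "graph_vcomp A B f g g x (graph_id2 A B g) = x"
    if "g \<in> hom A B" "x \<in> htpy_classes A B f g"
    using that by (auto elim!: htpy_classesE simp: graph_id2_def graph_vcomp_htpy_class
        homotopies_singleton_iff concat_htpy_singleton_right)
  show "graph_vcomp A B f h k (graph_vcomp A B f g h x y) z =
      graph_vcomp A B f g k x (graph_vcomp A B g h k y z)"
    if "x \<in> htpy_classes A B f g" "y \<in> htpy_classes A B g h" "z \<in> htpy_classes A B h k"
    using that by (auto elim!: htpy_classesE simp: graph_vcomp_htpy_class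
        concat_htpy_in_homotopies concat_htpy_assoc homotopies_not_Nil)
  show "graph_hcomp A B C f f' g g' x y
      \<in> htpy_classes A C (graph_comp A B C f g) (graph_comp A B C f' g')"
    if "is_graph A" "x \<in> htpy_classes A B f f'" "y \<in> htpy_classes B C g g'"
    using that by (auto elim!: htpy_classesE simp: graph_hcomp_htpy_class graph_comp_def
        intro!: htpy_class_in_htpy_classes hcomp_htpy_in_homotopies)
  show "graph_hcomp A A B (id_hom A) (id_hom A) f f' (graph_id2 A A (id_hom A)) x = x"
    if "is_graph A" "f \<in> hom A B" "f' \<in> hom A B" "x \<in> htpy_classes A B f f'"
    using that by (auto elim!: htpy_classesE simp: graph_id2_def graph_hcomp_htpy_class
        homotopies_singleton_iff id_hom_in_hom hcomp_htpy_id_left compose_id_hom)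
  show "graph_hcomp A B B f f' (id_hom B) (id_hom B) x (graph_id2 B B (id_hom B)) = x"
    if "is_graph A" "is_graph B" "f \<in> hom A B" "f' \<in> hom A B" "x \<in> htpy_classes A B f f'"
    using that by (auto elim!: htpy_classesE simp: graph_id2_def graph_hcomp_htpy_class
        homotopies_singleton_iff id_hom_in_hom hcomp_htpy_id_right compose_id_hom)
  show "graph_hcomp A C D (graph_comp A B C f g) (graph_comp A B C f' g') h h'
        (graph_hcomp A B C f f' g g' x y) z =
      graph_hcomp A B D f f' (graph_comp B C D g h) (graph_comp B C D g' h') x
        (graph_hcomp B C D g g' h h' y z)"
    if "is_graph A" "is_graph B" "f \<in> hom A B" "f' \<in> hom A B" "x \<in> htpy_classes A B f f'"
      "y \<in> htpy_classes B C g g'" "z \<in> htpy_classes C D h h'"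
    using that by (auto elim!: htpy_classesE simp: graph_comp_def graph_hcomp_htpy_class
        hcomp_htpy_in_homotopies hcomp_htpy_assoc compose_hom_assoc)
  show "graph_hcomp A B C f f g g (graph_id2 A B f) (graph_id2 B C g) =
      graph_id2 A C (graph_comp A B C f g)"
    if "is_graph A" "f \<in> hom A B" "g \<in> hom B C"
    using that by (simp add: graph_id2_def graph_comp_def graph_hcomp_htpy_class
        homotopies_singleton_iff hcomp_htpy_def post_whisker_def pre_whisker_def concat_htpy_def)
  show "graph_hcomp A B C f f'' g g'' (graph_vcomp A B f f' f'' x x')
        (graph_vcomp B C g g' g'' y y') =
      graph_vcomp A C (graph_comp A B C f g) (graph_comp A B C f' g') (graph_comp A B C f'' g'')
        (graph_hcomp A B C f f' g g' x y) (graph_hcomp A B C f' f'' g' g'' x' y')"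
    if "is_graph A" "x \<in> htpy_classes A B f f'" "x' \<in> htpy_classes A B f' f''"
      "y \<in> htpy_classes B C g g'" "y' \<in> htpy_classes B C g' g''"
  proof -
    note prems = that
    obtain \<alpha> where \<alpha>: "\<alpha> \<in> homotopies A B f f'" "x = htpy_class A B f f' \<alpha>"
      using prems(2) by (rule htpy_classesE)
    obtain \<alpha>' where \<alpha>': "\<alpha>' \<in> homotopies A B f' f''" "x' = htpy_class A B f' f'' \<alpha>'"
      using prems(3) by (rule htpy_classesE)
    obtain \<beta> where \<beta>: "\<beta> \<in> homotopies B C g g'" "y = htpy_class B C g g' \<beta>"
      using prems(4) by (rule htpy_classesE)
    obtain \<beta>' where \<beta>': "\<beta>' \<in> homotopies B C g' g''" "y' = htpy_class B C g' g'' \<beta>'"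
      using prems(5) by (rule htpy_classesE)
    note A = prems(1)
    note cells = \<alpha>(1) \<alpha>'(1) \<beta>(1) \<beta>'(1)
    \<comment> \<open>Both sides become classes of explicit lists, and these lists are homotopic but
      in general not equal.\<close>
    show ?thesis
      unfolding \<alpha>(2) \<alpha>'(2) \<beta>(2) \<beta>'(2) graph_comp_def
        graph_hcomp_htpy_class[OF A cells(1,3)] graph_hcomp_htpy_class[OF A cells(2,4)]
        graph_vcomp_htpy_class[OF cells(1,2)] graph_vcomp_htpy_class[OF cells(3,4)]
        graph_hcomp_htpy_class[OF A concat_htpy_in_homotopies[OF cells(1,2)]
          concat_htpy_in_homotopies[OF cells(3,4)]]
        graph_vcomp_htpy_class[OF hcomp_htpy_in_homotopies[OF A cells(1,3)]
          hcomp_htpy_in_homotopies[OF A cells(2,4)]]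
      by (rule htpy_class_eqI[OF hcomp_interchange[OF A cells]])
  qed
qed

text \<open>The locale predicate alone does not tie the operations to representatives; the two
  further conjuncts record that the unions defining them are the single classes given by
  concatenation and by g \<alpha> * \<beta> f'.\<close>

theorem theorem3p18:
  shows "two_category {G :: 'a ugraph. is_graph G} hom htpy_classes
           id_hom graph_comp graph_id2 graph_vcomp graph_hcomp \<and>
         (\<forall>(G :: 'a ugraph) (H :: 'a ugraph) f f' f'' \<alpha> \<alpha>'.
            is_graph G \<longrightarrow> is_graph H \<longrightarrow>
            f \<in> hom G H \<longrightarrow> f' \<in> hom G H \<longrightarrow> f'' \<in> hom G H \<longrightarrow>
            \<alpha> \<in> homotopies G H f f' \<longrightarrow> \<alpha>' \<in> homotopies G H f' f'' \<longrightarrow>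
            concat_htpy \<alpha> \<alpha>' \<in> homotopies G H f f'' \<and>
            graph_vcomp G H f f' f'' (htpy_class G H f f' \<alpha>) (htpy_class G H f' f'' \<alpha>') =
              htpy_class G H f f'' (concat_htpy \<alpha> \<alpha>')) \<and>
         (\<forall>(G :: 'a ugraph) (H :: 'a ugraph) (K :: 'a ugraph) f f' g g' \<alpha> \<beta>.
            is_graph G \<longrightarrow> is_graph H \<longrightarrow> is_graph K \<longrightarrow>
            f \<in> hom G H \<longrightarrow> f' \<in> hom G H \<longrightarrow> g \<in> hom H K \<longrightarrow> g' \<in> hom H K \<longrightarrow>
            \<alpha> \<in> homotopies G H f f' \<longrightarrow> \<beta> \<in> homotopies H K g g' \<longrightarrow>
            hcomp_htpy G f' g \<alpha> \<beta> \<in>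
              homotopies G K (graph_comp G H K f g) (graph_comp G H K f' g') \<and>
            graph_hcomp G H K f f' g g' (htpy_class G H f f' \<alpha>) (htpy_class H K g g' \<beta>) =
              htpy_class G K (graph_comp G H K f g) (graph_comp G H K f' g')
                (hcomp_htpy G f' g \<alpha> \<beta>))"
proof (intro conjI allI impI)
  show "two_category {G :: 'a ugraph. is_graph G} hom htpy_classes
          id_hom graph_comp graph_id2 graph_vcomp graph_hcomp"
    by (rule two_category_graphs)
next
  fix G H :: "'a ugraph" and f f' f'' \<alpha> \<alpha>'
  assume "\<alpha> \<in> homotopies G H f f'" "\<alpha>' \<in> homotopies G H f' f''"
  then show "concat_htpy \<alpha> \<alpha>' \<in> homotopies G H f f''"
    and "graph_vcomp G H f f' f'' (htpy_class G H f f' \<alpha>) (htpy_class G H f' f'' \<alpha>') =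
      htpy_class G H f f'' (concat_htpy \<alpha> \<alpha>')"
    by (simp_all add: concat_htpy_in_homotopies graph_vcomp_htpy_class)
next
  fix G H K :: "'a ugraph" and f f' g g' \<alpha> \<beta>
  assume "is_graph G" "\<alpha> \<in> homotopies G H f f'" "\<beta> \<in> homotopies H K g g'"
  then show "hcomp_htpy G f' g \<alpha> \<beta> \<in>
        homotopies G K (graph_comp G H K f g) (graph_comp G H K f' g')"
    and "graph_hcomp G H K f f' g g' (htpy_class G H f f' \<alpha>) (htpy_class H K g g' \<beta>) =
      htpy_class G K (graph_comp G H K f g) (graph_comp G H K f' g') (hcomp_htpy G f' g \<alpha> \<beta>)"
    unfolding graph_comp_def by (simp_all add: hcomp_htpy_in_homotopies graph_hcomp_htpy_class)
qed

end
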